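(* Let $G$ be a flag with $n\ge 10$ vertices. Then $G$ contains a set of $\lceil n/25\rceil+1$ pairwise disjoint edges.
   Context: Let $\mathcal C=S^1\times\mathbb R$, where $S^1$ is $[0,1]$ with $0$ and $1$ identified; each point $p$ has coordinates $(p_x,p_y)$ with $0\le p_x<1$. A cylindrical graph is a graph drawn on $\mathcal C$ with vertices as distinct points and edges as Jordan arcs joining their endpoints, with no overlapping edges and no edge through a vertex. It is simple if every two edges meet in at most one point (a common endpoint or a proper crossing), complete if all pairs of vertices are joined. A curve is $x$-monotone if every vertical line $l_{x=a}=\{p:p_x=a\}$ meets it at most once; the graph is monotone if all edges are $x$-monotone and no two vertices share an $x$-coordinate, and no vertex has $x$-coordinate $0$. A flag is a complete monotone simple cylindrical graph such that the line $l_{x=0}$ intersects every edge in its relative interior. Two edges are disjoint if they share no point. *)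

theory Defs
  imports "HOL-Analysis.Analysis"
begin

text \<open>The cylinder S^1 x R, realised as the subset {(z,y). |z| = 1} of complex x real,
  so that it carries the correct topology (x = 0 and x = 1 identified).
  A point (z,y) has coordinates (p_x, p_y) where z = cis(2 pi p_x), 0 <= p_x < 1, and p_y = y.\<close>

type_synonym cpoint = "complex \<times> real"

definition cyl :: "cpoint set" where
  "cyl = {p. norm (fst p) = 1}"

definition xc :: "cpoint \<Rightarrow> real" where
  "xc p = (THE t. 0 \<le> t \<and> t < 1 \<and> fst p = cis (2 * pi * t))"

definition yc :: "cpoint \<Rightarrow> real" where
  "yc p = snd p"

definition vline :: "real \<Rightarrow> cpoint set" where
  "vline a = {p \<in> cyl. xc p = a}"

definition x_monotone :: "cpoint set \<Rightarrow> bool" where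
  "x_monotone S \<longleftrightarrow> (\<forall>a. \<forall>p \<in> S \<inter> vline a. \<forall>q \<in> S \<inter> vline a. p = q)"

text \<open>Proper crossing of two x-monotone curves S, T at a common point p: the vertical order
  of the two curves swaps at p, i.e. on lines just to the left and just to the right of p
  (taken modulo 1) the curves are in opposite vertical order.\<close>
definition proper_crossing :: "cpoint set \<Rightarrow> cpoint set \<Rightarrow> cpoint \<Rightarrow> bool" where
  "proper_crossing S T p \<longleftrightarrow> p \<in> S \<and> p \<in> T \<and>
     (\<exists>\<epsilon>>0. \<forall>\<delta>. 0 < \<delta> \<and> \<delta> < \<epsilon> \<longrightarrow>
        (\<exists>q1\<in>S. \<exists>q2\<in>T. \<exists>r1\<in>S. \<exists>r2\<in>T.
           xc q1 = frac (xc p + \<delta>) \<and> xc q2 = frac (xc p + \<delta>) \<and>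
           xc r1 = frac (xc p - \<delta>) \<and> xc r2 = frac (xc p - \<delta>) \<and>
           (yc q1 - yc q2) * (yc r1 - yc r2) < 0))"

definition edge_img :: "(cpoint set \<Rightarrow> real \<Rightarrow> cpoint) \<Rightarrow> cpoint \<Rightarrow> cpoint \<Rightarrow> cpoint set" where
  "edge_img E u v = path_image (E {u, v})"

definition complete_cyl_graph :: "cpoint set \<Rightarrow> (cpoint set \<Rightarrow> real \<Rightarrow> cpoint) \<Rightarrow> bool" where
  "complete_cyl_graph V E \<longleftrightarrow> finite V \<and> V \<subseteq> cyl \<and>
     (\<forall>u\<in>V. \<forall>v\<in>V. u \<noteq> v \<longrightarrow>
        arc (E {u, v}) \<and> {pathstart (E {u, v}), pathfinish (E {u, v})} = {u, v} \<and>
        edge_img E u v \<subseteq> cyl \<and> (\<forall>w \<in> V - {u, v}. w \<notin> edge_img E u v))"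

definition simple_cyl_graph :: "cpoint set \<Rightarrow> (cpoint set \<Rightarrow> real \<Rightarrow> cpoint) \<Rightarrow> bool" where
  "simple_cyl_graph V E \<longleftrightarrow>
     (\<forall>u\<in>V. \<forall>v\<in>V. \<forall>w\<in>V. \<forall>z\<in>V. u \<noteq> v \<and> w \<noteq> z \<and> {u, v} \<noteq> {w, z} \<longrightarrow>
        (\<forall>p \<in> edge_img E u v \<inter> edge_img E w z. \<forall>q \<in> edge_img E u v \<inter> edge_img E w z. p = q) \<and>
        (\<forall>p \<in> edge_img E u v \<inter> edge_img E w z.
           p \<in> {u, v} \<inter> {w, z} \<or> proper_crossing (edge_img E u v) (edge_img E w z) p))"

definition monotone_cyl_graph :: "cpoint set \<Rightarrow> (cpoint set \<Rightarrow> real \<Rightarrow> cpoint) \<Rightarrow> bool" where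
  "monotone_cyl_graph V E \<longleftrightarrow>
     (\<forall>u\<in>V. \<forall>v\<in>V. u \<noteq> v \<longrightarrow> x_monotone (edge_img E u v)) \<and>
     inj_on xc V \<and> (\<forall>v\<in>V. xc v \<noteq> 0)"

definition flag :: "cpoint set \<Rightarrow> (cpoint set \<Rightarrow> real \<Rightarrow> cpoint) \<Rightarrow> bool" where
  "flag V E \<longleftrightarrow> complete_cyl_graph V E \<and> monotone_cyl_graph V E \<and> simple_cyl_graph V E \<and>
     (\<forall>u\<in>V. \<forall>v\<in>V. u \<noteq> v \<longrightarrow> (\<exists>p \<in> edge_img E u v. xc p = 0 \<and> p \<noteq> u \<and> p \<noteq> v))"

definition graph_edges :: "cpoint set \<Rightarrow> cpoint set set" where
  "graph_edges V = {{u, v} | u v. u \<in> V \<and> v \<in> V \<and> u \<noteq> v}"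

end

theory Submission
  imports Defs
begin

text \<open>Let u be to the left of v.  Since the edge uv crosses the line x = 0, it runs from v to the
  right, once around the seam, to u; unrolled, it is the graph of a continuous function on
  [xc v, xc u + 1].  For four vertices a, b, c, d from left to right the edges ac and bd are always
  disjoint: a crossing would, by the intermediate value theorem applied along the 4-cycle formed by
  ab, bd, cd, ac, force ab and cd to cross twice, once over [d, a + 1] and once over [b, c].
  So with the vertices w 0, w 1, ... sorted by x-coordinate, the edges w i w (i + k) for i < k
  are pairwise disjoint as soon as 2 k is at most the number of vertices.\<close>

section \<open>Unrolling the cylinder\<close>

lemma cis_2pi_eq_iff: "cis (2 * pi * s) = cis (2 * pi * t) \<longleftrightarrow> s - t \<in> \<int>"
proof
  assume "cis (2 * pi * s) = cis (2 * pi * t)"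
  then have "exp (\<i> * of_real (2 * pi * s)) = exp (\<i> * of_real (2 * pi * t))"
    by (simp add: cis_conv_exp)
  then obtain n :: int where "\<i> * of_real (2 * pi * s) = \<i> * of_real (2 * pi * t) + of_int (2 * n) * pi * \<i>"
    unfolding exp_eq by auto
  then have "Im (\<i> * of_real (2 * pi * s)) = Im (\<i> * of_real (2 * pi * t) + of_int (2 * n) * pi * \<i>)"
    by simp
  then have "2 * pi * s = 2 * pi * t + 2 * n * pi" by simp
  then have "2 * pi * (s - t) = 2 * pi * n" by (simp add: algebra_simps)
  then have "s - t = n" by simp
  then show "s - t \<in> \<int>" by simp
next
  assume "s - t \<in> \<int>"
  then obtain n :: int where "s = t + n" by (auto elim!: Ints_cases simp: algebra_simps)
  then have "2 * pi * s = 2 * pi * t + 2 * pi * n" by (simp add: algebra_simps)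
  then show "cis (2 * pi * s) = cis (2 * pi * t)"
    by (simp flip: cis_mult)
qed

lemma xc_eqI:
  assumes "fst p = cis (2 * pi * t)"
  shows "xc p = frac t"
  unfolding xc_def
proof (rule the_equality)
  have "t - frac t \<in> \<int>" by (simp add: frac_def)
  then show "0 \<le> frac t \<and> frac t < 1 \<and> fst p = cis (2 * pi * frac t)"
    using assms by (simp add: frac_lt_1 cis_2pi_eq_iff)
next
  fix s assume s: "0 \<le> s \<and> s < 1 \<and> fst p = cis (2 * pi * s)"
  then have "t - s \<in> \<int>" using assms by (metis cis_2pi_eq_iff)
  then show "s = frac t"
    using s frac_unique_iff[of t s] by auto
qed

text \<open>The parameter is a lift of the angle to the real line, so \<open>r\<close> may exceed 1
  and the seam then lies inside the interval. The bound \<open>r < l + 1\<close> keeps the curve to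
  less than one full turn, so each point has a single parameter.\<close>

definition unrolled :: "cpoint set \<Rightarrow> (real \<Rightarrow> real) \<Rightarrow> real \<Rightarrow> real \<Rightarrow> bool" where
  "unrolled S g l r \<longleftrightarrow> continuous_on {l..r} g \<and> l \<le> r \<and> r < l + 1 \<and>
     S = (\<lambda>t. (cis (2 * pi * t), g t)) ` {l..r}"

lemma unrolled_mem_iff:
  assumes "unrolled S g l r" "t \<in> {l..r}"
  shows "(cis (2 * pi * t), y) \<in> S \<longleftrightarrow> y = g t"
proof
  assume "(cis (2 * pi * t), y) \<in> S"
  then obtain s where s: "s \<in> {l..r}" "cis (2 * pi * t) = cis (2 * pi * s)" "y = g s"
    using assms by (auto simp: unrolled_def)
  then have "t - s \<in> \<int>" by (simp add: cis_2pi_eq_iff)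
  moreover have "\<bar>t - s\<bar> < 1" using assms s by (auto simp: unrolled_def)
  ultimately have "t = s" using Ints_nonzero_abs_less1 by fastforce
  then show "y = g t" using s by simp
next
  assume "y = g t"
  then show "(cis (2 * pi * t), y) \<in> S" using assms by (auto simp: unrolled_def)
qed

lemma unrolled_yc_eq:
  assumes S: "unrolled S g l r" and t: "t \<in> {l..r}" and q: "q \<in> S" and x: "xc q = frac t"
  shows "yc q = g t"
proof -
  obtain s where s: "q = (cis (2 * pi * s), g s)"
    using S q by (auto simp: unrolled_def)
  then have "frac s = frac t" using x xc_eqI[of q s] by simp
  then have "s - t = of_int (\<lfloor>s\<rfloor> - \<lfloor>t\<rfloor>)" by (simp add: frac_def)
  then have "s - t \<in> \<int>" by (metis Ints_of_int)
  then have "q = (cis (2 * pi * t), g s)" using s cis_2pi_eq_iff by simp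
  then show ?thesis using unrolled_mem_iff[OF S t] q by (simp add: yc_def)
qed

section \<open>Angle lifts of x-monotone arcs\<close>

text \<open>The first coordinate never vanishes, so over the contractible interval it has a
  continuous logarithm, whose imaginary part is the angle. Parameters with angles differing by whole
  turns lie on one vertical line; monotonicity identifies the points, and injectivity of the arc the
  parameters.\<close>

lemma x_monotone_arc_lift:
  assumes arc: "arc \<gamma>" and cyl: "path_image \<gamma> \<subseteq> cyl" and mono: "x_monotone (path_image \<gamma>)"
  obtains \<theta> where "continuous_on {0..1} \<theta>"
    and "\<And>t. t \<in> {0..1} \<Longrightarrow> fst (\<gamma> t) = cis (2 * pi * \<theta> t)"
    and "\<And>s t. \<lbrakk>s \<in> {0..1}; t \<in> {0..1}; \<theta> s - \<theta> t \<in> \<int>\<rbrakk> \<Longrightarrow> s = t"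
proof -
  have mem: "\<gamma> t \<in> path_image \<gamma>" if "t \<in> {0..1}" for t
    using that by (auto simp: path_image_def)
  have norm1: "norm (fst (\<gamma> t)) = 1" if "t \<in> {0..1}" for t
    using mem[OF that] cyl by (auto simp: cyl_def)
  have cont: "continuous_on {0..1} (\<lambda>t. fst (\<gamma> t))"
    using arc by (intro continuous_intros) (simp add: arc_def path_def)
  have nz: "fst (\<gamma> t) \<noteq> 0" if "t \<in> {0..1}" for t
    using norm1[OF that] by auto
  obtain h where h: "continuous_on {0..1} h" "\<And>t. t \<in> {0..1} \<Longrightarrow> fst (\<gamma> t) = exp (h t)"
    using continuous_logarithm_on_contractible[OF cont _ nz] convex_imp_contractible[of "{0..1::real}"]
    by auto
  define \<theta> where "\<theta> = (\<lambda>t. Im (h t) / (2 * pi))"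
  have lift: "fst (\<gamma> t) = cis (2 * pi * \<theta> t)" if "t \<in> {0..1}" for t
  proof -
    have "Re (h t) = 0" using norm1[OF that] h(2)[OF that] by simp
    then show ?thesis using h(2)[OF that] by (simp add: \<theta>_def exp_eq_polar)
  qed
  show thesis
  proof
    show "continuous_on {0..1} \<theta>" unfolding \<theta>_def by (intro continuous_intros h(1)) simp
    show "fst (\<gamma> t) = cis (2 * pi * \<theta> t)" if "t \<in> {0..1}" for t by (rule lift[OF that])
    fix s t :: real assume st: "s \<in> {0..1}" "t \<in> {0..1}" "\<theta> s - \<theta> t \<in> \<int>"
    then have "fst (\<gamma> s) = fst (\<gamma> t)" by (simp add: lift cis_2pi_eq_iff)
    then have "xc (\<gamma> s) = xc (\<gamma> t)" by (simp add: xc_def)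
    then have "\<gamma> s = \<gamma> t"
      using mono mem[OF st(1)] mem[OF st(2)] cyl unfolding x_monotone_def vline_def by blast
    then show "s = t" using arc st by (auto simp: arc_def inj_on_def)
  qed
qed

text \<open>The seam point \<open>p\<close> fixes which translate of the lift to take: it has an
  integer angle strictly between the two end angles. Heights are then read off through the inverse
  of \<open>\<theta>\<close>.\<close>

lemma increasing_lift_unrolled:
  assumes \<delta>: "path \<delta>" and lift: "\<And>t. t \<in> {0..1} \<Longrightarrow> fst (\<delta> t) = cis (2 * pi * \<theta> t)"
    and cont: "continuous_on {0..1} \<theta>" and smono: "strict_mono_on {0..1} \<theta>"
    and inj: "\<And>s t. \<lbrakk>s \<in> {0..1}; t \<in> {0..1}; \<theta> s - \<theta> t \<in> \<int>\<rbrakk> \<Longrightarrow> s = t"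
    and p: "p \<in> path_image \<delta>" "xc p = 0" "p \<noteq> \<delta> 0" "p \<noteq> \<delta> 1"
  shows "\<exists>g. unrolled (path_image \<delta>) g (xc (\<delta> 0)) (xc (\<delta> 1) + 1)"
proof -
  obtain t0 where t0: "p = \<delta> t0" "t0 \<in> {0..1}" using p(1) by (auto simp: path_image_def)
  then have "t0 \<noteq> 0" "t0 \<noteq> 1" using p by auto
  have "frac (\<theta> t0) = 0" using xc_eqI[OF lift[OF t0(2)]] t0 p(2) by simp
  then obtain k :: int where k: "\<theta> t0 = k" by (auto elim: Ints_cases)
  have lt: "\<theta> 0 < k" "k < \<theta> 1"
    using smono t0(2) \<open>t0 \<noteq> 0\<close> \<open>t0 \<noteq> 1\<close> k[symmetric] by (auto simp: strict_mono_on_def)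
  have img: "\<theta> ` {0..1} = {\<theta> 0..\<theta> 1}"
  proof
    show "\<theta> ` {0..1} \<subseteq> {\<theta> 0..\<theta> 1}"
      using strict_mono_on_imp_mono_on[OF smono] by (auto simp: mono_on_def)
    show "{\<theta> 0..\<theta> 1} \<subseteq> \<theta> ` {0..1}"
      using IVT'[of \<theta> 0 _ 1] cont by fastforce
  qed
  \<comment> \<open>A longer lift would attain \<open>\<theta> 0 + 1\<close>, against injectivity
    modulo 1.\<close>
  have len: "\<theta> 1 < \<theta> 0 + 1"
  proof (rule ccontr)
    assume "\<not> \<theta> 1 < \<theta> 0 + 1"
    then have "\<theta> 0 + 1 \<in> \<theta> ` {0..1}" unfolding img by auto
    then obtain t where t: "t \<in> {0..1}" "\<theta> t = \<theta> 0 + 1" by auto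
    then show False using inj[of t 0] by auto
  qed
  define \<phi> where "\<phi> = inv_into {0..1} \<theta>"
  have \<phi>: "\<phi> (\<theta> t) = t" if "t \<in> {0..1}" for t
    using that inj unfolding \<phi>_def by (intro inv_into_f_f) (auto simp: inj_on_def)
  have cont\<phi>: "continuous_on {\<theta> 0..\<theta> 1} \<phi>"
    using continuous_on_inv[OF cont _ ] \<phi> img by fastforce
  \<comment> \<open>Subtracting \<open>k - 1\<close> puts the seam at 1. The start angle then falls
    in (0,1) and the end angle in (1,2), which accounts for the \<open>+ 1\<close> at the right end
    only.\<close>
  define m where "m = real_of_int k - 1"
  define g where "g = (\<lambda>x. snd (\<delta> (\<phi> (x + m))))"
  have xc0: "xc (\<delta> 0) = \<theta> 0 - m"
  proof -
    have "xc (\<delta> 0) = frac (\<theta> 0)" by (intro xc_eqI lift) simp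
    also have "\<dots> = \<theta> 0 - m"
      using lt len unfolding frac_unique_iff m_def by auto
    finally show ?thesis .
  qed
  have xc1: "xc (\<delta> 1) + 1 = \<theta> 1 - m"
  proof -
    have "xc (\<delta> 1) = frac (\<theta> 1)" by (intro xc_eqI lift) simp
    also have "\<dots> = \<theta> 1 - k"
      using lt len unfolding frac_unique_iff by auto
    finally show ?thesis by (simp add: m_def)
  qed
  have shift: "(\<lambda>x. x + m) ` {\<theta> 0 - m..\<theta> 1 - m} = {\<theta> 0..\<theta> 1}" by simp
  have "continuous_on {\<theta> 0 - m..\<theta> 1 - m} g"
    unfolding g_def
  proof (intro continuous_intros continuous_on_compose2[OF _ continuous_on_compose2[OF cont\<phi>]])
    show "continuous_on {0..1} \<delta>" using \<delta> by (simp add: path_def)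
    show "(\<lambda>x. \<phi> (x + m)) ` {\<theta> 0 - m..\<theta> 1 - m} \<subseteq> {0..1}"
    proof (rule image_subsetI)
      fix x assume "x \<in> {\<theta> 0 - m..\<theta> 1 - m}"
      then have "x + m \<in> \<theta> ` {0..1}" unfolding img by auto
      then show "\<phi> (x + m) \<in> {0..1}" using \<phi> by (auto simp del: atLeastAtMost_iff)
    qed
  qed auto
  moreover have "path_image \<delta> = (\<lambda>t. (cis (2 * pi * t), g t)) ` {\<theta> 0 - m..\<theta> 1 - m}"
  proof -
    have "(\<lambda>t. (cis (2 * pi * t), g t)) ` {\<theta> 0 - m..\<theta> 1 - m}
      = (\<lambda>t. (cis (2 * pi * (t - m)), g (t - m))) ` \<theta> ` {0..1}"
      unfolding img shift[symmetric] by (simp add: image_image del: image_add_atLeastAtMost')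
    also have "\<dots> = \<delta> ` {0..1}"
      unfolding image_image
    proof (rule image_cong[OF refl])
      fix t :: real assume t: "t \<in> {0..1}"
      have "cis (2 * pi * (\<theta> t - m)) = cis (2 * pi * \<theta> t)"
        by (simp add: cis_2pi_eq_iff m_def)
      then show "(cis (2 * pi * (\<theta> t - m)), g (\<theta> t - m)) = \<delta> t"
        using lift[OF t] by (simp add: g_def \<phi>[OF t] prod_eq_iff)
    qed
    finally show ?thesis by (simp add: path_image_def)
  qed
  ultimately have "unrolled (path_image \<delta>) g (xc (\<delta> 0)) (xc (\<delta> 1) + 1)"
    unfolding unrolled_def xc0 xc1 using lt len by auto
  then show ?thesis by blast
qed

lemma seam_arc_unrolled:
  assumes arc: "arc \<gamma>" and cyl: "path_image \<gamma> \<subseteq> cyl" and mono: "x_monotone (path_image \<gamma>)"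
    and ends: "{pathstart \<gamma>, pathfinish \<gamma>} = {u, v}" and uv: "xc u < xc v"
    and p: "p \<in> path_image \<gamma>" "xc p = 0" "p \<noteq> u" "p \<noteq> v"
  shows "\<exists>g. unrolled (path_image \<gamma>) g (xc v) (xc u + 1)"
proof -
  obtain \<theta> where \<theta>: "continuous_on {0..1} \<theta>"
    "\<And>t. t \<in> {0..1} \<Longrightarrow> fst (\<gamma> t) = cis (2 * pi * \<theta> t)"
    "\<And>s t. \<lbrakk>s \<in> {0..1}; t \<in> {0..1}; \<theta> s - \<theta> t \<in> \<int>\<rbrakk> \<Longrightarrow> s = t"
    using x_monotone_arc_lift[OF arc cyl mono] by blast
  have inj: "inj_on \<theta> {0..1}" using \<theta>(3) by (auto simp: inj_on_def)
  \<comment> \<open>A continuous injective lift is strictly monotone, so the arc or its reverse has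
    an increasing one. The orientation is forgotten here: only the image and the unordered pair of
    ends are kept.\<close>
  have "\<exists>\<delta> g. path_image \<delta> = path_image \<gamma> \<and> {\<delta> 0, \<delta> 1} = {u, v} \<and>
      unrolled (path_image \<delta>) g (xc (\<delta> 0)) (xc (\<delta> 1) + 1)"
  proof -
    consider "strict_mono_on {0..1} \<theta>" | "strict_antimono_on {0..1} \<theta>"
      using inj injective_eq_monotone_map[of "{0..1}" \<theta>] \<theta>(1) by auto
    then show ?thesis
    proof cases
      assume sm: "strict_mono_on {0..1} \<theta>"
      have e: "{\<gamma> 0, \<gamma> 1} = {u, v}" using ends by (simp add: pathstart_def pathfinish_def)
      have "\<exists>g. unrolled (path_image \<gamma>) g (xc (\<gamma> 0)) (xc (\<gamma> 1) + 1)"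
      proof (rule increasing_lift_unrolled[where \<theta> = \<theta>])
        show "path \<gamma>" using arc by (rule arc_imp_path)
        show "p \<noteq> \<gamma> 0" "p \<noteq> \<gamma> 1" using p e by (auto simp: doubleton_eq_iff)
      qed (use p \<theta> sm in auto)
      then show ?thesis using e by blast
    next
      assume sm: "strict_antimono_on {0..1} \<theta>"
      let ?\<delta> = "reversepath \<gamma>"
      have e: "{?\<delta> 0, ?\<delta> 1} = {u, v}"
        using ends by (auto simp: pathstart_def pathfinish_def reversepath_def)
      have "\<exists>g. unrolled (path_image ?\<delta>) g (xc (?\<delta> 0)) (xc (?\<delta> 1) + 1)"
      proof (rule increasing_lift_unrolled[where \<theta> = "\<lambda>t. \<theta> (1 - t)"])
        show "path ?\<delta>" using arc by (simp add: arc_imp_path)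
        show "fst (?\<delta> t) = cis (2 * pi * \<theta> (1 - t))" if "t \<in> {0..1}" for t
          using that \<theta>(2)[of "1 - t"] by (simp add: reversepath_def)
        show "continuous_on {0..1} (\<lambda>t. \<theta> (1 - t))"
          by (rule continuous_on_compose2[OF \<theta>(1)]) (auto intro!: continuous_intros)
        show "strict_mono_on {0..1} (\<lambda>t. \<theta> (1 - t))"
          using sm by (auto simp: monotone_on_def)
        show "s = t" if "s \<in> {0..1}" "t \<in> {0..1}" "\<theta> (1 - s) - \<theta> (1 - t) \<in> \<int>" for s t
          using that \<theta>(3)[of "1 - s" "1 - t"] by simp
        show "p \<noteq> ?\<delta> 0" "p \<noteq> ?\<delta> 1" using p e by (auto simp: doubleton_eq_iff)
      qed (use p in auto)
      then show ?thesis using e by (metis path_image_reversepath)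
    qed
  qed
  then obtain \<delta> g where \<delta>: "path_image \<delta> = path_image \<gamma>" "{\<delta> 0, \<delta> 1} = {u, v}"
      "unrolled (path_image \<delta>) g (xc (\<delta> 0)) (xc (\<delta> 1) + 1)" by blast
  \<comment> \<open>Being shorter than a full turn recovers the orientation: the increasing arc must
    start at the right-hand vertex.\<close>
  have "xc (\<delta> 1) < xc (\<delta> 0)" using \<delta>(3) by (simp add: unrolled_def)
  then have "\<delta> 0 = v" "\<delta> 1 = u" using \<delta>(2) uv by (auto simp: doubleton_eq_iff)
  then show ?thesis using \<delta> by auto
qed

section \<open>Four vertices\<close>

text \<open>A continuous difference without zeros keeps its sign on a connected set. Half-open
  intervals must be covered too, for curves that meet at the omitted end.\<close>

lemma same_side:
  fixes f g :: "real \<Rightarrow> real"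
  assumes "f s < g s" "connected S" "continuous_on S f" "continuous_on S g"
    "\<And>t. t \<in> S \<Longrightarrow> f t \<noteq> g t" "s \<in> S" "t \<in> S"
  shows "f t < g t"
proof (rule ccontr)
  assume "\<not> f t < g t"
  then have "0 \<le> f t - g t" by simp
  have "connected ((\<lambda>x. f x - g x) ` S)"
    using assms by (intro connected_continuous_image continuous_intros) auto
  then have "0 \<in> (\<lambda>x. f x - g x) ` S"
    using assms \<open>0 \<le> f t - g t\<close> connectedD_interval[of _ "f s - g s" "f t - g t" 0] by auto
  then show False using assms by force
qed

text \<open>Here \<open>a\<close>, ..., \<open>d\<close> are x-coordinates, and an edge from x to a
  later y is a function on [y, x+1]; \<open>ends\<close> says that edges agree at their common
  vertices. Only one direction of crossing is excluded; the other follows by reflecting heights. The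
  half-open ranges in \<open>ab_ac\<close> and \<open>bd_cd\<close> leave out the shared
  vertex.\<close>

lemma no_crossing_four_cycle:
  fixes ab ac bd cd :: "real \<Rightarrow> real"
  assumes ord: "0 < a" "a < b" "b < c" "c < d" "d < 1"
    and cont: "continuous_on {b..a+1} ab" "continuous_on {c..a+1} ac"
      "continuous_on {d..b+1} bd" "continuous_on {d..c+1} cd"
    and ends: "ab (a+1) = ac (a+1)" "ab b = bd (b+1)" "ac c = cd (c+1)" "bd d = cd d"
    and ac_cd: "\<And>t. t \<in> {d..a+1} \<Longrightarrow> ac t \<noteq> cd t"
    and ab_bd: "\<And>t. t \<in> {d..a+1} \<Longrightarrow> ab t \<noteq> bd t"
    and ab_ac: "\<And>t. t \<in> {c..<a+1} \<Longrightarrow> ab t \<noteq> ac t"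
    and bd_cd: "\<And>t. t \<in> {d<..b+1} \<Longrightarrow> bd t \<noteq> cd t"
    and ab_cd: "\<And>s t. \<lbrakk>s \<in> {d..a+1}; t \<in> {b..c}; ab s = cd s\<rbrakk> \<Longrightarrow> ab t \<noteq> cd (t+1)"
  shows "\<not> (ac d < bd d \<and> bd (a+1) < ac (a+1))"
proof
  assume cross: "ac d < bd d \<and> bd (a+1) < ac (a+1)"
  note sub = continuous_on_subset[OF cont(1)] continuous_on_subset[OF cont(2)]
    continuous_on_subset[OF cont(3)] continuous_on_subset[OF cont(4)]
  \<comment> \<open>Facts 1 and 2 carry the assumed order across [d, a+1], from one end to the
    other. Facts 3 and 4 continue it to c on the left and to b+1 on the right.\<close>
  have 1: "ac (a+1) < cd (a+1)"
    by (rule same_side[of _ d _ "{d..a+1}"]) (use ord cross ends ac_cd in \<open>auto intro!: sub\<close>)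
  have 2: "bd d < ab d"
    by (rule same_side[of _ "a+1" _ "{d..a+1}"])
      (use ord cross ends ab_bd in \<open>auto intro!: sub simp: eq_commute\<close>)
  have 3: "ac c < ab c"
    by (rule same_side[of _ d _ "{c..<a+1}"])
      (use ord cross 2 ab_ac in \<open>auto intro!: sub simp: eq_commute\<close>)
  have 4: "bd (b+1) < cd (b+1)"
    by (rule same_side[of _ "a+1" _ "{d<..b+1}"])
      (use ord cross 1 bd_cd in \<open>auto intro!: sub\<close>)
  \<comment> \<open>At d, \<open>ab\<close> is above \<open>bd\<close>, which there equals
    \<open>cd\<close>; at a+1, \<open>ab\<close> equals \<open>ac\<close>, which is below
    \<open>cd\<close>.\<close>
  have "\<exists>s\<in>{d..a+1}. ab s = cd s"
  proof (rule ccontr)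
    assume "\<not> ?thesis"
    then have none: "\<And>s. s \<in> {d..a+1} \<Longrightarrow> cd s \<noteq> ab s" by metis
    have "cd (a+1) < ab (a+1)"
      by (rule same_side[of _ d _ "{d..a+1}"]) (use ord 2 ends none in \<open>auto intro!: sub\<close>)
    then show False using 1 ends by simp
  qed
  \<comment> \<open>Over [b, c] the edge \<open>cd\<close> is in its second turn, hence the shift.
    Fact 4 puts \<open>ab\<close> below at b, and fact 3 puts it above at c.\<close>
  moreover have "\<exists>t\<in>{b..c}. ab t = cd (t+1)"
  proof (rule ccontr)
    assume none: "\<not> ?thesis"
    have "ab c < cd (c+1)"
    proof (rule same_side[of ab b "\<lambda>t. cd (t+1)" "{b..c}"])
      show "continuous_on {b..c} (\<lambda>t. cd (t+1))"
        by (rule continuous_on_compose2[OF cont(4)]) (use ord in \<open>auto intro!: continuous_intros\<close>)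
    qed (use none ord 4 ends in \<open>auto intro!: sub\<close>)
    then show False using 3 ends by simp
  qed
  ultimately show False using ab_cd by blast
qed

section \<open>Edges of a flag as real functions\<close>

lemma flag_edge_unrolled:
  assumes "flag V E" "u \<in> V" "v \<in> V" "xc u < xc v"
  obtains g where "unrolled (edge_img E u v) g (xc v) (xc u + 1)"
    "g (xc v) = yc v" "g (xc u + 1) = yc u" "0 < xc u" "xc v < 1"
    "u = (cis (2 * pi * xc u), yc u)" "v = (cis (2 * pi * xc v), yc v)"
proof -
  have "u \<noteq> v" using assms by auto
  note A = assms(1)[unfolded flag_def complete_cyl_graph_def monotone_cyl_graph_def]
  have coord: "0 \<le> xc w \<and> xc w < 1 \<and> w = (cis (2 * pi * xc w), yc w)" if "w \<in> V" for w
  proof -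
    have "norm (fst w) = 1" using A that by (auto simp: cyl_def)
    \<comment> \<open>The description defining \<open>xc\<close> needs an angle to exist; the
      complex argument supplies one, up to an integer.\<close>
    then have "fst w = cis (2 * pi * (Arg (fst w) / (2 * pi)))"
      using cis_Arg[of "fst w"] by (cases "fst w = 0") (auto simp: sgn_div_norm)
    moreover from xc_eqI[OF this] have x: "xc w = frac (Arg (fst w) / (2 * pi))" .
    moreover have "cis (2 * pi * frac s) = cis (2 * pi * s)" for s
      by (simp add: cis_2pi_eq_iff frac_def)
    ultimately have "fst w = cis (2 * pi * xc w)" by metis
    then show ?thesis using x by (simp add: frac_lt_1 yc_def prod_eq_iff)
  qed
  obtain p where p: "p \<in> edge_img E u v" "xc p = 0" "p \<noteq> u" "p \<noteq> v"
  proof -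
    have "\<forall>u\<in>V. \<forall>v\<in>V. u \<noteq> v \<longrightarrow> (\<exists>p\<in>edge_img E u v. xc p = 0 \<and> p \<noteq> u \<and> p \<noteq> v)"
      using assms(1) unfolding flag_def by (elim conjE)
    then show thesis using that assms(2,3) \<open>u \<noteq> v\<close> by metis
  qed
  have arc: "arc (E {u, v})" and ends: "{pathstart (E {u, v}), pathfinish (E {u, v})} = {u, v}"
    and cyl: "path_image (E {u, v}) \<subseteq> cyl" and mono: "x_monotone (path_image (E {u, v}))"
    using A assms(2,3) \<open>u \<noteq> v\<close> by (auto simp: edge_img_def)
  obtain g where g: "unrolled (edge_img E u v) g (xc v) (xc u + 1)"
    using seam_arc_unrolled[OF arc cyl mono ends assms(4)] p unfolding edge_img_def by blast
  have mem: "u \<in> edge_img E u v" "v \<in> edge_img E u v"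
    using ends pathstart_in_path_image[of "E {u, v}"] pathfinish_in_path_image[of "E {u, v}"]
    unfolding edge_img_def by (auto simp: doubleton_eq_iff)
  have I: "xc v \<in> {xc v..xc u + 1}" "xc u + 1 \<in> {xc v..xc u + 1}"
    using g by (auto simp: unrolled_def)
  have "g (xc v) = yc v"
    using unrolled_yc_eq[OF g I(1) mem(2)] coord[OF assms(3)] by (simp add: frac_eq)
  moreover have "g (xc u + 1) = yc u"
    using unrolled_yc_eq[OF g I(2) mem(1)] coord[OF assms(2)] by (simp add: frac_eq frac_1_eq)
  moreover have "xc u \<noteq> 0" using A assms(2) by auto
  ultimately show thesis using that g coord[OF assms(2)] coord[OF assms(3)] by auto
qed

text \<open>A proper crossing is a local statement about lines close to t. Since the curves meet
  nowhere else on [m, n], the order just left of t extends to m and the order just right of t to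
  n.\<close>

lemma proper_crossing_sign_change:
  assumes S: "unrolled S f l r" and T: "unrolled T g l' r'"
    and t: "t \<in> {m<..<n}" and sub: "{m..n} \<subseteq> {l..r}" "{m..n} \<subseteq> {l'..r'}"
    and cross: "proper_crossing S T (cis (2 * pi * t), y)"
    and uniq: "\<And>s. \<lbrakk>s \<in> {m..n}; f s = g s\<rbrakk> \<Longrightarrow> s = t"
  shows "f m < g m \<and> g n < f n \<or> g m < f m \<and> f n < g n"
proof -
  have cf: "continuous_on A f" and cg: "continuous_on A g" if "A \<subseteq> {m..n}" for A
    using that S T sub unfolding unrolled_def by (meson continuous_on_subset subset_trans)+
  obtain \<epsilon> where \<epsilon>: "\<epsilon> > 0" and C: "\<And>\<delta>. \<lbrakk>0 < \<delta>; \<delta> < \<epsilon>\<rbrakk> \<Longrightarrow>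
      \<exists>q1\<in>S. \<exists>q2\<in>T. \<exists>r1\<in>S. \<exists>r2\<in>T.
         xc q1 = frac (frac t + \<delta>) \<and> xc q2 = frac (frac t + \<delta>) \<and>
         xc r1 = frac (frac t - \<delta>) \<and> xc r2 = frac (frac t - \<delta>) \<and>
         (yc q1 - yc q2) * (yc r1 - yc r2) < 0"
    using cross xc_eqI[of "(cis (2 * pi * t), y)" t] unfolding proper_crossing_def by auto
  \<comment> \<open>Halving makes all three bounds strict, so both test lines lie in the crossing
    neighbourhood and in [m, n].\<close>
  define \<delta> where "\<delta> = Min {\<epsilon>, t - m, n - t} / 2"
  have \<delta>: "0 < \<delta>" "\<delta> < \<epsilon>" "\<delta> < t - m" "\<delta> < n - t"
    using \<epsilon> t by (auto simp: \<delta>_def min_def)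
  have fr: "frac (frac t + e) = frac (t + e)" for e
  proof -
    have "frac t + e - (t + e) \<in> \<int>" by (simp add: frac_def)
    then have "cis (2 * pi * (frac t + e)) = cis (2 * pi * (t + e))" by (simp only: cis_2pi_eq_iff)
    then show ?thesis using xc_eqI[of "(cis (2 * pi * (t + e)), 0)"] by (metis fst_conv)
  qed
  have in1: "t + \<delta> \<in> {m..n}" "t - \<delta> \<in> {m..n}" using \<delta> t by auto
  obtain q1 q2 r1 r2 where q: "q1 \<in> S" "q2 \<in> T" "r1 \<in> S" "r2 \<in> T"
    "xc q1 = frac (t + \<delta>)" "xc q2 = frac (t + \<delta>)" "xc r1 = frac (t - \<delta>)" "xc r2 = frac (t - \<delta>)"
    "(yc q1 - yc q2) * (yc r1 - yc r2) < 0"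
    using C[OF \<delta>(1,2)] fr[of \<delta>] fr[of "-\<delta>"] by auto
  have val: "yc q1 = f (t + \<delta>)" "yc q2 = g (t + \<delta>)" "yc r1 = f (t - \<delta>)" "yc r2 = g (t - \<delta>)"
    using unrolled_yc_eq[OF S] unrolled_yc_eq[OF T] q in1 sub by blast+
  have "(f (t + \<delta>) - g (t + \<delta>)) * (f (t - \<delta>) - g (t - \<delta>)) < 0" using q(9) val by simp
  moreover have ne: "f x \<noteq> g x" "g x \<noteq> f x" if "x \<in> {m..<t} \<or> x \<in> {t<..n}" for x
    using uniq[of x] that t by force+
  moreover have "f m < g m" if "f (t - \<delta>) < g (t - \<delta>)"
    by (rule same_side[where f = f and g = g and t = m and S = "{m..<t}" and s = "t - \<delta>"]) 
      (use that \<delta> t ne in \<open>auto intro!: cf cg\<close>)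
  moreover have "g m < f m" if "g (t - \<delta>) < f (t - \<delta>)"
    by (rule same_side[where f = g and g = f and t = m and S = "{m..<t}" and s = "t - \<delta>"]) 
      (use that \<delta> t ne in \<open>auto intro!: cf cg\<close>)
  moreover have "f n < g n" if "f (t + \<delta>) < g (t + \<delta>)"
    by (rule same_side[where f = f and g = g and t = n and S = "{t<..n}" and s = "t + \<delta>"]) 
      (use that \<delta> t ne in \<open>auto intro!: cf cg\<close>)
  moreover have "g n < f n" if "g (t + \<delta>) < f (t + \<delta>)"
    by (rule same_side[where f = g and g = f and t = n and S = "{t<..n}" and s = "t + \<delta>"]) 
      (use that \<delta> t ne in \<open>auto intro!: cf cg\<close>)
  ultimately show ?thesis by (auto simp: mult_less_0_iff)
qed

text \<open>A common point can only lie over [d, a+1], where both lifts are defined. It is not a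
  vertex, so it is a proper crossing, and as the only common point it reverses the order of
  \<open>ac\<close> and \<open>bd\<close> between d and a+1. The 4-cycle argument rules out both
  directions.\<close>

lemma flag_interleaved_disjoint:
  assumes F: "flag V E" and V: "a \<in> V" "b \<in> V" "c \<in> V" "d \<in> V"
    and ord: "xc a < xc b" "xc b < xc c" "xc c < xc d"
  shows "edge_img E a c \<inter> edge_img E b d = {}"
proof (rule ccontr)
  assume "edge_img E a c \<inter> edge_img E b d \<noteq> {}"
  then obtain p where p: "p \<in> edge_img E a c" "p \<in> edge_img E b d" by auto
  have ord': "xc a < xc c" "xc b < xc d" "xc a < xc d" using ord by auto
  obtain ab where ab: "unrolled (edge_img E a b) ab (xc b) (xc a + 1)" "ab (xc b) = yc b" "ab (xc a + 1) = yc a"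
    and a: "0 < xc a" "a = (cis (2 * pi * xc a), yc a)" and b: "b = (cis (2 * pi * xc b), yc b)"
    using flag_edge_unrolled[OF F V(1,2) ord(1)] by metis
  obtain ac where ac: "unrolled (edge_img E a c) ac (xc c) (xc a + 1)" "ac (xc c) = yc c" "ac (xc a + 1) = yc a"
    using flag_edge_unrolled[OF F V(1,3) ord'(1)] by metis
  obtain bd where bd: "unrolled (edge_img E b d) bd (xc d) (xc b + 1)" "bd (xc d) = yc d" "bd (xc b + 1) = yc b"
    using flag_edge_unrolled[OF F V(2,4) ord'(2)] by metis
  obtain cd where cd: "unrolled (edge_img E c d) cd (xc d) (xc c + 1)" "cd (xc d) = yc d" "cd (xc c + 1) = yc c"
    and d: "xc d < 1" "d = (cis (2 * pi * xc d), yc d)" and c: "c = (cis (2 * pi * xc c), yc c)"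
    using flag_edge_unrolled[OF F V(3,4) ord(3)] by metis
  have dist: "a \<noteq> b" "a \<noteq> c" "a \<noteq> d" "b \<noteq> c" "b \<noteq> d" "c \<noteq> d" using ord by auto
  have once: "p = q" if "u \<in> V" "v \<in> V" "w \<in> V" "z \<in> V" "u \<noteq> v" "w \<noteq> z" "{u, v} \<noteq> {w, z}"
    "p \<in> edge_img E u v" "p \<in> edge_img E w z" "q \<in> edge_img E u v" "q \<in> edge_img E w z"
    for u v w z p q
    using F that unfolding flag_def simple_cyl_graph_def by blast
  have cis_shift: "cis (2 * pi * (s + 1)) = cis (2 * pi * s)" for s
    by (simp add: cis_2pi_eq_iff)
  have cis_ne: "cis (2 * pi * s) \<noteq> cis (2 * pi * t)" if "s < t" "t < s + 1" for s t
  proof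
    assume "cis (2 * pi * s) = cis (2 * pi * t)"
    then have "s - t \<in> \<int>" by (simp add: cis_2pi_eq_iff)
    then show False using Ints_nonzero_abs_less1[of "s - t"] that by auto
  qed
  \<comment> \<open>Edges that share a vertex q have no other common point, so a meeting parameter
    differs from the angle s of q by an integer; the window [s, s+2) leaves two values.\<close>
  have meet: "t = s \<or> t = s + 1"
    if S: "unrolled (edge_img E u v) f l r" "unrolled (edge_img E w z) g l' r'"
      and t: "t \<in> {l..r}" "t \<in> {l'..r'}" "f t = g t"
      and q: "cis (2 * pi * s) = fst q" "q \<in> edge_img E u v" "q \<in> edge_img E w z" "s \<le> t" "t < s + 2"
      and V: "u \<in> V" "v \<in> V" "w \<in> V" "z \<in> V" "u \<noteq> v" "w \<noteq> z" "{u, v} \<noteq> {w, z}"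
    for u v w z f g l r l' r' s t q
  proof -
    have "(cis (2 * pi * t), f t) = q"
      using once[OF V _ _ q(2,3)] unrolled_mem_iff[OF S(1) t(1)] unrolled_mem_iff[OF S(2) t(2)] t(3) by simp
    then have "t - s \<in> \<int>" using q(1) cis_2pi_eq_iff by (metis fst_conv)
    then obtain k :: int where k: "t - s = k" by (auto elim: Ints_cases)
    then have "k = 0 \<or> k = 1" using q by linarith
    then show ?thesis using k by auto
  qed
  have self: "u \<in> edge_img E u v \<and> v \<in> edge_img E u v" if "u \<in> V" "v \<in> V" "u \<noteq> v" for u v
  proof -
    have "{pathstart (E {u, v}), pathfinish (E {u, v})} = {u, v}"
      using F that unfolding flag_def complete_cyl_graph_def by blast
    then show ?thesis
      using pathstart_in_path_image[of "E {u, v}"] pathfinish_in_path_image[of "E {u, v}"]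
      unfolding edge_img_def by (auto simp: doubleton_eq_iff)
  qed
  have fa: "cis (2 * pi * xc a) = fst a" and fb: "cis (2 * pi * xc b) = fst b"
    and fc: "cis (2 * pi * xc c) = fst c" and fd: "cis (2 * pi * xc d) = fst d"
    using a b c d by (metis fst_conv)+
  note U = ab(1) ac(1) bd(1) cd(1)
  have pairs: "{a, c} \<noteq> {c, d}" "{a, b} \<noteq> {b, d}" "{a, b} \<noteq> {a, c}" "{b, d} \<noteq> {c, d}"
    using dist by (auto simp: doubleton_eq_iff)
  \<comment> \<open>In this and the next three facts the range of t avoids both lifts of the shared
    vertex.\<close>
  have ac_cd: "ac t \<noteq> cd t" if "t \<in> {xc d..xc a + 1}" for t
  proof
    assume eq: "ac t = cd t"
    have "t = xc c \<or> t = xc c + 1"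
      by (rule meet[OF U(2,4) _ _ eq fc]) (use that V dist self ord a d pairs in auto)
    then show False using that ord a d by auto
  qed
  have ab_bd: "ab t \<noteq> bd t" if "t \<in> {xc d..xc a + 1}" for t
  proof
    assume eq: "ab t = bd t"
    have "t = xc b \<or> t = xc b + 1"
      by (rule meet[OF U(1,3) _ _ eq fb]) (use that V dist self ord a d pairs in auto)
    then show False using that ord a d by auto
  qed
  have ab_ac: "ab t \<noteq> ac t" if "t \<in> {xc c..<xc a + 1}" for t
  proof
    assume eq: "ab t = ac t"
    have "t = xc a \<or> t = xc a + 1"
      by (rule meet[OF U(1,2) _ _ eq fa]) (use that V dist self ord a d pairs in auto)
    then show False using that ord a d by auto
  qed
  have bd_cd: "bd t \<noteq> cd t" if "t \<in> {xc d<..xc b + 1}" for t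
  proof
    assume eq: "bd t = cd t"
    have "t = xc d \<or> t = xc d + 1"
      by (rule meet[OF U(3,4) _ _ eq fd]) (use that V dist self ord a d pairs in auto)
    then show False using that ord a d by auto
  qed
  have ab_cd: "ab t \<noteq> cd (t + 1)"
    if st: "s \<in> {xc d..xc a + 1}" "t \<in> {xc b..xc c}" and eq: "ab s = cd s" for s t
  proof
    assume eq': "ab t = cd (t + 1)"
    have s: "s \<in> {xc b..xc a + 1}" "s \<in> {xc d..xc c + 1}" using st ord by auto
    have t: "t \<in> {xc b..xc a + 1}" "t + 1 \<in> {xc d..xc c + 1}" using st ord a d by auto
    \<comment> \<open>Simplicity would make the two meetings one point, yet t < s < t + 1 gives
      different angles.\<close>
    have "(cis (2 * pi * s), ab s) = (cis (2 * pi * t), ab t)"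
    proof (rule once[of a b c d])
      show "(cis (2 * pi * s), ab s) \<in> edge_img E c d"
        using unrolled_mem_iff[OF U(4) s(2)] eq by simp
      show "(cis (2 * pi * t), ab t) \<in> edge_img E c d"
        using unrolled_mem_iff[OF U(4) t(2)] eq' cis_shift by simp
    qed (use V dist unrolled_mem_iff[OF U(1)] s t in \<open>auto simp: doubleton_eq_iff\<close>)
    moreover have "t < s" "s < t + 1" using st ord by auto
    ultimately show False using cis_ne[of t s] by simp
  qed
  obtain t where t: "t \<in> {xc c..xc a + 1}" "p = (cis (2 * pi * t), ac t)"
    using p(1) U(2) by (auto simp: unrolled_def)
  obtain s where s: "s \<in> {xc d..xc b + 1}" "p = (cis (2 * pi * s), bd s)"
    using p(2) U(3) by (auto simp: unrolled_def)
  have "t - s \<in> \<int>" using s t cis_2pi_eq_iff by auto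
  \<comment> \<open>The ranges [c, a+1] and [d, b+1] are so placed that |t - s| < 1.\<close>
  then have "t = s" using Ints_nonzero_abs_less1[of "t - s"] s t ord a d by auto
  have notin: "w \<notin> edge_img E u v" if "u \<in> V" "v \<in> V" "w \<in> V" "u \<noteq> v" "w \<noteq> u" "w \<noteq> v" for u v w
    using F that unfolding flag_def complete_cyl_graph_def by blast
  \<comment> \<open>At either end of [d, a+1] the common point would be a vertex on an edge it does
    not belong to: d on \<open>ac\<close>, or a on \<open>bd\<close>.\<close>
  have "t \<noteq> xc d"
  proof
    assume "t = xc d"
    then have "p = d" using s \<open>t = s\<close> bd d by simp
    then show False using p notin[of a c d] V dist by auto
  qed
  moreover have "t \<noteq> xc a + 1"
  proof
    assume "t = xc a + 1"
    then have "p = a" using t ac(3) a cis_shift by simp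
    then show False using p notin[of b d a] V dist by auto
  qed
  ultimately have tin: "t \<in> {xc d<..<xc a + 1}" using s t \<open>t = s\<close> by auto
  have "proper_crossing (edge_img E a c) (edge_img E b d) p"
  proof -
    have "{a, c} \<inter> {b, d} = {}" "{a, c} \<noteq> {b, d}" using dist by (auto simp: doubleton_eq_iff)
    moreover have "p \<in> {a, c} \<inter> {b, d} \<or> proper_crossing (edge_img E a c) (edge_img E b d) p"
      if "{a, c} \<noteq> {b, d}"
    proof -
      have "simple_cyl_graph V E" using F by (simp add: flag_def)
      from this[unfolded simple_cyl_graph_def, rule_format, OF V(1,3,2,4)]
      show ?thesis using that dist p by blast
    qed
    ultimately show ?thesis by blast
  qed
  then have pc: "proper_crossing (edge_img E a c) (edge_img E b d) (cis (2 * pi * t), ac t)"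
    using t by simp
  have uniq: "r = t" if r: "r \<in> {xc d..xc a + 1}" "ac r = bd r" for r
  proof -
    have r': "r \<in> {xc c..xc a + 1}" "r \<in> {xc d..xc b + 1}" using r ord by auto
    have "(cis (2 * pi * r), ac r) = p"
      using once[OF V(1,3,2,4) dist(2,5) _ _ _ p] unrolled_mem_iff[OF U(2) r'(1)]
        unrolled_mem_iff[OF U(3) r'(2)] r dist by (auto simp: doubleton_eq_iff)
    then have "cis (2 * pi * r) = cis (2 * pi * t)" using t by simp
    then have "r - t \<in> \<int>" by (simp add: cis_2pi_eq_iff)
    then show ?thesis using Ints_nonzero_abs_less1[of "r - t"] r tin ord a d by auto
  qed
  have change: "ac (xc d) < bd (xc d) \<and> bd (xc a + 1) < ac (xc a + 1) \<or>
      bd (xc d) < ac (xc d) \<and> ac (xc a + 1) < bd (xc a + 1)"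
    by (rule proper_crossing_sign_change[OF U(2,3) tin _ _ pc uniq]) (use ord in auto)
  have cont: "continuous_on {xc b..xc a + 1} ab" "continuous_on {xc c..xc a + 1} ac"
    "continuous_on {xc d..xc b + 1} bd" "continuous_on {xc d..xc c + 1} cd"
    using U by (auto simp: unrolled_def)
  have "\<not> (ac (xc d) < bd (xc d) \<and> bd (xc a + 1) < ac (xc a + 1))"
    by (rule no_crossing_four_cycle[where ab = ab and ac = ac and bd = bd and cd = cd and b = "xc b" and c = "xc c"])
      (use a d ord cont ab ac bd cd ac_cd ab_bd ab_ac bd_cd ab_cd in auto)
  \<comment> \<open>Reflecting heights turns the opposite change of order into the one already
    excluded.\<close>
  moreover have "\<not> (- ac (xc d) < - bd (xc d) \<and> - bd (xc a + 1) < - ac (xc a + 1))"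
    by (rule no_crossing_four_cycle[where ab = "\<lambda>x. - ab x" and ac = "\<lambda>x. - ac x"
          and bd = "\<lambda>x. - bd x" and cd = "\<lambda>x. - cd x" and b = "xc b" and c = "xc c"])
      (use a d ord cont ab ac bd cd ac_cd ab_bd ab_ac bd_cd ab_cd in \<open>auto intro!: continuous_on_minus\<close>)
  ultimately show False using change by auto
qed

section \<open>Many disjoint edges\<close>

text \<open>For i < j < k the indices satisfy i < j < i + k < j + k, so the edges joining
  \<open>w i\<close> to \<open>w (i + k)\<close> interleave pairwise.\<close>

lemma flag_disjoint_edges:
  assumes F: "flag V E" and k: "2 * k \<le> card V"
  shows "\<exists>M \<subseteq> graph_edges V. card M = k \<and>
           (\<forall>e\<in>M. \<forall>f\<in>M. e \<noteq> f \<longrightarrow> path_image (E e) \<inter> path_image (E f) = {})"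
proof -
  have fin: "finite V" and inj: "inj_on xc V"
    using F by (auto simp: flag_def complete_cyl_graph_def monotone_cyl_graph_def)
  define xs where "xs = sorted_list_of_set (xc ` V)"
  define w where "w = (\<lambda>i. inv_into V xc (xs ! i))"
  have len: "length xs = card V" using fin inj by (simp add: xs_def card_image)
  have nth: "xs ! i \<in> xc ` V" if "i < card V" for i
    using that len fin nth_mem[of i xs] by (simp add: xs_def)
  have w: "w i \<in> V" "xc (w i) = xs ! i" if "i < card V" for i
    using nth[OF that] unfolding w_def by (auto intro: inv_into_into f_inv_into_f)
  have less: "xc (w i) < xc (w j)" if "i < j" "j < card V" for i j
  proof -
    have "sorted_wrt (<) xs" using fin by (simp add: xs_def)
    then show ?thesis using that len w by (simp add: sorted_wrt_nth_less)
  qed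
  have w_eq: "i = j" if "w i = w j" "i < card V" "j < card V" for i j
    using that less by (metis linorder_neqE_nat less_irrefl)
  define e where "e = (\<lambda>i. {w i, w (i + k)})"
  \<comment> \<open>Equal pairs with the ends swapped would need i = j + k, impossible for i <
    k.\<close>
  have "inj_on e {..<k}"
    using w_eq k by (force simp: inj_on_def e_def doubleton_eq_iff)
  then have "card (e ` {..<k}) = k" by (simp add: card_image)
  moreover have "e ` {..<k} \<subseteq> graph_edges V"
  proof (rule image_subsetI)
    fix i assume i: "i \<in> {..<k}"
    then have "w i \<noteq> w (i + k)" using k w_eq[of i "i + k"] by auto
    then show "e i \<in> graph_edges V"
      using i k w(1)[of i] w(1)[of "i + k"] unfolding graph_edges_def e_def mem_Collect_eq
      by (intro exI[of _ "w i"] exI[of _ "w (i + k)"]) simp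
  qed
  moreover have "path_image (E (e i)) \<inter> path_image (E (e j)) = {}" if "i < j" "j < k" for i j
    using flag_interleaved_disjoint[OF F, of "w i" "w j" "w (i + k)" "w (j + k)"] that k w less
    by (simp add: edge_img_def e_def)
  then have "\<forall>i<k. \<forall>j<k. e i \<noteq> e j \<longrightarrow> path_image (E (e i)) \<inter> path_image (E (e j)) = {}"
    by (metis Int_commute linorder_neqE_nat)
  ultimately show ?thesis by (intro exI[of _ "e ` {..<k}"]) auto
qed

theorem theorem5:
  fixes V :: "cpoint set" and E :: "cpoint set \<Rightarrow> real \<Rightarrow> cpoint"
  assumes "flag V E" and "card V \<ge> 10"
  shows "\<exists>M \<subseteq> graph_edges V. card M = nat \<lceil>real (card V) / 25\<rceil> + 1 \<and>
           (\<forall>e\<in>M. \<forall>f\<in>M. e \<noteq> f \<longrightarrow> path_image (E e) \<inter> path_image (E f) = {})"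
proof (rule flag_disjoint_edges[OF assms(1)])
  \<comment> \<open>With n = \<open>card V\<close>, doubling gives a value below 2n/25 + 4, which is
    at most n + 1 for n at least 10; integrality then gives the bound n.\<close>
  have "real (nat \<lceil>real (card V) / 25\<rceil>) < real (card V) / 25 + 1"
    by linarith
  then have "real (2 * (nat \<lceil>real (card V) / 25\<rceil> + 1)) < real (card V) + 1"
    using assms(2) by simp
  then show "2 * (nat \<lceil>real (card V) / 25\<rceil> + 1) \<le> card V"
    by linarith
qed

end
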